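(* Let $0<\alpha<1$, $1<\beta<2$, $e_1,e_2>0$, $L,T>0$, and let $N\ge 2$, $M\ge 2$ be integers. Let $W$ be the block lower triangular Toeplitz matrix and $P_W$ the block lower bi-diagonal Toeplitz matrix defined in the context. Then all eigenvalues of the preconditioned matrix $P_W^{-1}W$ are equal to $1$.
   Context: Put $h=L/N$, $\tau=T/M$, $\sigma=1-\alpha/2$. Spatial coefficients: $g_0^{(\beta)}=1$, $g_k^{(\beta)}=\left(1-\frac{\beta+1}{k}\right)g_{k-1}^{(\beta)}$ for $k\ge1$; $\omega_0^{(\beta)}=\frac{\beta}{2}g_0^{(\beta)}$, $\omega_k^{(\beta)}=\frac{\beta}{2}g_k^{(\beta)}+\frac{2-\beta}{2}g_{k-1}^{(\beta)}$ for $k\ge1$. $G_\beta\in\mathbb{R}^{(N-1)\times(N-1)}$ is the Toeplitz matrix with entries $[G_\beta]_{ij}=\omega_{i-j+1}^{(\beta)}$ if $i-j\ge-1$ and $[G_\beta]_{ij}=0$ otherwise. $K_N=e_1G_\beta+e_2G_\beta^T$. Temporal coefficients: $a_0=\sigma^{1-\alpha}$, $a_l=(l+\sigma)^{1-\alpha}-(l-1+\sigma)^{1-\alpha}$ for $l\ge1$, and $b_l=\frac{1}{2-\alpha}\left[(l+\sigma)^{2-\alpha}-(l-1+\sigma)^{2-\alpha}\right]-\frac12\left[(l+\sigma)^{1-\alpha}-(l-1+\sigma)^{1-\alpha}\right]$ for $l\ge1$. Set $c_0^{(\alpha,\sigma)}=\frac{\tau^{-\alpha}}{\Gamma(2-\alpha)}(a_0+b_1)$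 and $c_s^{(\alpha,\sigma)}=\frac{\tau^{-\alpha}}{\Gamma(2-\alpha)}(a_s+b_{s+1}-b_s)$ for $s\ge1$. Blocks (each of size $(N-1)\times(N-1)$, $I$ the identity): $A_0=h^\beta c_0^{(\alpha,\sigma)}I-\sigma K_N$, $A_1=h^\beta\left(c_1^{(\alpha,\sigma)}-c_0^{(\alpha,\sigma)}\right)I-(1-\sigma)K_N$, $A_k=h^\beta\left(c_k^{(\alpha,\sigma)}-c_{k-1}^{(\alpha,\sigma)}\right)I$ for $2\le k\le M-2$. $W$ is the $(M-1)\times(M-1)$ block matrix whose $(i,j)$ block is $A_{i-j}$ if $i\ge j$ and $\mathbf{0}$ if $i<j$. $P_W$ is the $(M-1)\times(M-1)$ block matrix whose $(i,j)$ block is $A_0$ if $i=j$, $A_1$ if $i=j+1$, and $\mathbf{0}$ otherwise. $P_W$ is nonsingular, so $P_W^{-1}$ is defined. *)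

theory Defs
  imports
    "HOL-Analysis.Gamma_Function"
    "Jordan_Normal_Form.Gauss_Jordan_Elimination"
    "Jordan_Normal_Form.Spectral_Radius"
begin

text \<open>
  Matrix rows and columns are numbered from 0, as in \<^theory>\<open>Jordan_Normal_Form.Matrix\<close>. All Toeplitz
  entries and blocks depend only on the difference of the two indices, so this shift
  does not change them.
\<close>

definition offset :: "real \<Rightarrow> real" where
  "offset \<alpha> = 1 - \<alpha> / 2"

subsection \<open>Spatial discretisation\<close>

primrec g_coeff :: "real \<Rightarrow> nat \<Rightarrow> real" where
  "g_coeff \<beta> 0 = 1"
| "g_coeff \<beta> (Suc k) = (1 - (\<beta> + 1) / real (Suc k)) * g_coeff \<beta> k"

primrec omega_coeff :: "real \<Rightarrow> nat \<Rightarrow> real" where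
  "omega_coeff \<beta> 0 = \<beta> / 2 * g_coeff \<beta> 0"
| "omega_coeff \<beta> (Suc k) = \<beta> / 2 * g_coeff \<beta> (Suc k) + (2 - \<beta>) / 2 * g_coeff \<beta> k"

text \<open>The guard \<open>j \<le> i + 1\<close> is \<open>i - j \<ge> -1\<close>; it makes the natural-number subtraction exact.\<close>

definition G_mat :: "real \<Rightarrow> nat \<Rightarrow> real mat" where
  "G_mat \<beta> N = mat (N - 1) (N - 1) (\<lambda>(i, j). if j \<le> i + 1 then omega_coeff \<beta> (i + 1 - j) else 0)"

definition K_mat :: "real \<Rightarrow> real \<Rightarrow> real \<Rightarrow> nat \<Rightarrow> real mat" where
  "K_mat \<beta> e1 e2 N = e1 \<cdot>\<^sub>m G_mat \<beta> N + e2 \<cdot>\<^sub>m transpose_mat (G_mat \<beta> N)"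

subsection \<open>Temporal discretisation\<close>

definition a_coeff :: "real \<Rightarrow> nat \<Rightarrow> real" where
  "a_coeff \<alpha> l = (let \<sigma> = offset \<alpha> in
     if l = 0 then \<sigma> powr (1 - \<alpha>)
     else (real l + \<sigma>) powr (1 - \<alpha>) - (real l - 1 + \<sigma>) powr (1 - \<alpha>))"

text \<open>Only meaningful, and only used, for \<open>l \<ge> 1\<close>.\<close>

definition b_coeff :: "real \<Rightarrow> nat \<Rightarrow> real" where
  "b_coeff \<alpha> l = (let \<sigma> = offset \<alpha> in
     1 / (2 - \<alpha>) * ((real l + \<sigma>) powr (2 - \<alpha>) - (real l - 1 + \<sigma>) powr (2 - \<alpha>))
     - 1 / 2 * ((real l + \<sigma>) powr (1 - \<alpha>) - (real l - 1 + \<sigma>) powr (1 - \<alpha>)))"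

definition c_coeff :: "real \<Rightarrow> real \<Rightarrow> nat \<Rightarrow> real" where
  "c_coeff \<alpha> \<tau> s = \<tau> powr (- \<alpha>) / Gamma (2 - \<alpha>) *
     (if s = 0 then a_coeff \<alpha> 0 + b_coeff \<alpha> 1
      else a_coeff \<alpha> s + b_coeff \<alpha> (s + 1) - b_coeff \<alpha> s)"

subsection \<open>Block matrices\<close>

text \<open>The flat matrix of an \<open>m \<times> m\<close> array of \<open>n \<times> n\<close> blocks.\<close>

definition block_mat :: "nat \<Rightarrow> nat \<Rightarrow> (nat \<Rightarrow> nat \<Rightarrow> 'a mat) \<Rightarrow> 'a mat" where
  "block_mat m n B = mat (m * n) (m * n)
     (\<lambda>(i, j). B (i div n) (j div n) $$ (i mod n, j mod n))"

definition A_block ::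
  "real \<Rightarrow> real \<Rightarrow> real \<Rightarrow> real \<Rightarrow> real \<Rightarrow> real \<Rightarrow> nat \<Rightarrow> nat \<Rightarrow> real mat" where
  "A_block \<alpha> \<beta> e1 e2 h \<tau> N k = (let \<sigma> = offset \<alpha>; c = c_coeff \<alpha> \<tau>; K = K_mat \<beta> e1 e2 N in
     if k = 0 then (h powr \<beta> * c 0) \<cdot>\<^sub>m 1\<^sub>m (N - 1) - \<sigma> \<cdot>\<^sub>m K
     else if k = 1 then (h powr \<beta> * (c 1 - c 0)) \<cdot>\<^sub>m 1\<^sub>m (N - 1) - (1 - \<sigma>) \<cdot>\<^sub>m K
     else (h powr \<beta> * (c k - c (k - 1))) \<cdot>\<^sub>m 1\<^sub>m (N - 1))"

definition W_mat ::
  "real \<Rightarrow> real \<Rightarrow> real \<Rightarrow> real \<Rightarrow> real \<Rightarrow> real \<Rightarrow> nat \<Rightarrow> nat \<Rightarrow> real mat" where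
  "W_mat \<alpha> \<beta> e1 e2 L T N M = (let A = A_block \<alpha> \<beta> e1 e2 (L / real N) (T / real M) N in
     block_mat (M - 1) (N - 1) (\<lambda>i j. if j \<le> i then A (i - j) else 0\<^sub>m (N - 1) (N - 1)))"

definition P_mat ::
  "real \<Rightarrow> real \<Rightarrow> real \<Rightarrow> real \<Rightarrow> real \<Rightarrow> real \<Rightarrow> nat \<Rightarrow> nat \<Rightarrow> real mat" where
  "P_mat \<alpha> \<beta> e1 e2 L T N M = (let A = A_block \<alpha> \<beta> e1 e2 (L / real N) (T / real M) N in
     block_mat (M - 1) (N - 1)
       (\<lambda>i j. if i = j then A 0 else if i = j + 1 then A 1 else 0\<^sub>m (N - 1) (N - 1)))"

end

theory Submission
  imports Defs
begin

text \<open>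
  The matrices \<open>W\<close> and \<open>P\<close> are block lower triangular with the same diagonal block \<open>A\<^sub>0\<close>. An
  eigenvalue \<open>k\<close> of \<open>P\<^sup>-\<^sup>1 W\<close> makes the pencil \<open>W - k P\<close> singular. This pencil is again block lower
  triangular, with diagonal blocks \<open>(1 - k) A\<^sub>0\<close>, and a block lower triangular matrix with
  nonsingular diagonal blocks is nonsingular (\<open>det_block_lower_triangular_nonzero\<close>, block
  forward substitution). So once \<open>A\<^sub>0\<close> is nonsingular, \<open>P\<close> is nonsingular and \<open>k = 1\<close> is the
  only possible eigenvalue; it occurs because a complex matrix of positive size has an
  eigenvalue.

  The analytic content is therefore that \<open>A\<^sub>0 = h\<^sup>\<beta> c\<^sub>0 I - \<sigma> K\<close> is nonsingular. This follows
  from \<open>v \<bullet> A\<^sub>0 v > 0\<close> for real \<open>v \<noteq> 0\<close>, which needs two facts: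

    \<^item> \<open>c\<^sub>0 > 0\<close> (\<open>c_coeff_0_pos\<close>), by estimating \<open>b\<^sub>1\<close> with the mean value theorem;

    \<^item> \<open>v \<bullet> K v \<le> 0\<close> (\<open>K_mat_form_nonpos\<close>). A matrix and its transpose have the same
      quadratic form, so \<open>K\<close> contributes \<open>e\<^sub>1 + e\<^sub>2\<close> times the form of \<open>G\<close>, and \<open>G\<close> may be replaced
      by its symmetric part. That part is a symmetric Toeplitz matrix with nonnegative
      off-diagonal entries and nonpositive row sums, hence negative semidefinite. The
      symmetrisation is essential: \<open>\<omega>\<^sub>2\<close> can be negative, while \<open>\<omega>\<^sub>0 + \<omega>\<^sub>2\<close> never is.
\<close>

section \<open>Signs of the discretisation coefficients\<close>

lemma g_coeff_nonneg:
  assumes "1 < \<beta>" "\<beta> < 2" "2 \<le> k"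
  shows "0 \<le> g_coeff \<beta> k"
  using \<open>2 \<le> k\<close>
proof (induction k rule: dec_induct)
  case base
  have "g_coeff \<beta> 2 = (\<beta> - 1) * \<beta> / 2"
    by (simp add: numeral_2_eq_2 field_simps)
  moreover have "0 \<le> (\<beta> - 1) * \<beta> / 2" using assms by simp
  ultimately show ?case by (simp only:)
next
  case (step k)
  then have "0 \<le> 1 - (\<beta> + 1) / real (Suc k)"
    using assms by (simp add: field_simps)
  then show ?case using step.IH by simp
qed

lemma Suc_times_g_coeff_Suc: "real (Suc n) * g_coeff \<beta> (Suc n) = (real n - \<beta>) * g_coeff \<beta> n"
  by (simp add: field_simps)

text \<open>
  The coefficients \<open>g\<^sub>k\<close> are those of \<open>(1 - z)\<^sup>\<beta>\<close>, so their partial sums are the coefficients of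
  \<open>(1 - z)\<close> to the power \<open>\<beta> - 1\<close>. Expressing them by the next \<open>g\<^sub>k\<close> reduces the sign of the sums
  to the sign of a single coefficient.
\<close>

lemma sum_g_coeff: "\<beta> * (\<Sum>k\<le>n. g_coeff \<beta> k) = - real (Suc n) * g_coeff \<beta> (Suc n)"
proof (induction n)
  case 0
  show ?case by simp
next
  case (Suc n)
  show ?case
    unfolding sum.atMost_Suc distrib_left Suc
    using Suc_times_g_coeff_Suc[of "Suc n" \<beta>] by (simp add: algebra_simps del: g_coeff.simps)
qed

lemma sum_g_coeff_nonpos:
  assumes "1 < \<beta>" "\<beta> < 2" "1 \<le> n"
  shows "(\<Sum>k\<le>n. g_coeff \<beta> k) \<le> 0"
proof -
  have "\<beta> * (\<Sum>k\<le>n. g_coeff \<beta> k) \<le> 0"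
    unfolding sum_g_coeff using g_coeff_nonneg[of \<beta> "Suc n"] assms
    by (intro mult_nonpos_nonneg) auto
  then show ?thesis using assms by (simp add: mult_le_0_iff)
qed

lemma omega_coeff_nonneg:
  assumes "1 < \<beta>" "\<beta> < 2" "3 \<le> k"
  shows "0 \<le> omega_coeff \<beta> k"
proof -
  obtain m where k: "k = Suc m" "2 \<le> m" using assms(3) by (cases k) auto
  show ?thesis
    using g_coeff_nonneg[of \<beta> m] g_coeff_nonneg[of \<beta> "Suc m"] assms k
    by (simp del: g_coeff.simps)
qed

lemma omega_coeff_0_2_nonneg:
  assumes "1 < \<beta>" "\<beta> < 2"
  shows "0 \<le> omega_coeff \<beta> 0 + omega_coeff \<beta> 2"
proof -
  have "omega_coeff \<beta> 0 + omega_coeff \<beta> 2 = \<beta> / 4 * ((\<beta> - 1) * (\<beta> + 2))"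
    by (simp add: numeral_2_eq_2 field_simps)
  moreover have "0 \<le> \<beta> / 4 * ((\<beta> - 1) * (\<beta> + 2))" using assms by simp
  ultimately show ?thesis by (simp only:)
qed

text \<open>
  A partial sum of the \<open>\<omega>\<^sub>k\<close> combines two consecutive partial sums of the \<open>g\<^sub>k\<close> with positive
  weights. The case \<open>n = 0\<close> is excluded because \<open>\<omega>\<^sub>0 + \<omega>\<^sub>1 = 1 - \<beta>\<^sup>2 / 2\<close> is positive
  for small \<open>\<beta>\<close>.
\<close>

lemma sum_omega_coeff_nonpos:
  assumes "1 < \<beta>" "\<beta> < 2" "1 \<le> n"
  shows "(\<Sum>k\<le>Suc n. omega_coeff \<beta> k) \<le> 0"
proof -
  have "(\<Sum>k\<le>Suc n. omega_coeff \<beta> k)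
      = \<beta> / 2 * (\<Sum>k\<le>Suc n. g_coeff \<beta> k) + (2 - \<beta>) / 2 * (\<Sum>k\<le>n. g_coeff \<beta> k)"
    unfolding sum.atMost_Suc_shift omega_coeff.simps sum.distrib sum_distrib_left[symmetric]
    by (simp only: distrib_left add.assoc)
  also have "\<dots> \<le> 0"
    using sum_g_coeff_nonpos[of \<beta> n] sum_g_coeff_nonpos[of \<beta> "Suc n"] assms
    by (intro add_nonpos_nonpos mult_nonneg_nonpos) auto
  finally show ?thesis .
qed

text \<open>
  Put \<open>p = 1 - \<alpha>\<close>. The first part of \<open>b\<^sub>1\<close> is the mean of \<open>x\<^sup>p\<close> over \<open>[\<sigma>, \<sigma> + 1]\<close>, hence at least
  \<open>\<sigma>\<^sup>p\<close>. The subtracted part is controlled by \<open>(\<sigma> + 1)\<^sup>p \<le> 3 \<sigma>\<^sup>p\<close>, a consequence of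
  \<open>\<sigma> + 1 \<le> 3 \<sigma>\<close> and \<open>p \<le> 1\<close>.
\<close>

lemma c_coeff_0_pos:
  assumes "0 < \<alpha>" "\<alpha> < 1" "0 < \<tau>"
  shows "0 < c_coeff \<alpha> \<tau> 0"
proof -
  define \<sigma> where "\<sigma> = offset \<alpha>"
  define p where "p = 1 - \<alpha>"
  have \<sigma>: "1/2 < \<sigma>" and p: "0 < p" "p < 1"
    using assms by (auto simp: \<sigma>_def p_def offset_def)
  have "\<exists>z. \<sigma> < z \<and> z < \<sigma> + 1 \<and> (\<sigma> + 1) powr (p + 1) - \<sigma> powr (p + 1)
      = (\<sigma> + 1 - \<sigma>) * ((p + 1) * z powr p)"
    using \<sigma> p by (intro MVT2) (auto intro!: derivative_eq_intros)
  then obtain z where z: "\<sigma> < z"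
    "(\<sigma> + 1) powr (p + 1) - \<sigma> powr (p + 1) = (p + 1) * z powr p" by auto
  have lower: "\<sigma> powr p \<le> z powr p" using z(1) \<sigma> p by (intro powr_mono2) auto
  have upper: "(\<sigma> + 1) powr p \<le> 3 * \<sigma> powr p"
  proof -
    have "(\<sigma> + 1) powr p \<le> (3 * \<sigma>) powr p" using \<sigma> p by (intro powr_mono2) auto
    also have "\<dots> = 3 powr p * \<sigma> powr p" using \<sigma> by (simp add: powr_mult)
    also have "\<dots> \<le> 3 powr 1 * \<sigma> powr p" using p by (intro mult_right_mono powr_mono) auto
    finally show ?thesis by simp
  qed
  have "0 < \<sigma> powr p" using \<sigma> by simp
  then have "0 < \<sigma> powr p + (z powr p - 1 / 2 * ((\<sigma> + 1) powr p - \<sigma> powr p))"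
    using lower upper by argo
  moreover have "a_coeff \<alpha> 0 + b_coeff \<alpha> 1
      = \<sigma> powr p + (z powr p - 1 / 2 * ((\<sigma> + 1) powr p - \<sigma> powr p))"
  proof -
    have "1 / (p + 1) * ((\<sigma> + 1) powr (p + 1) - \<sigma> powr (p + 1)) = z powr p"
      using z(2) p by simp
    then show ?thesis
      by (simp add: a_coeff_def b_coeff_def Let_def \<sigma>_def p_def add.commute)
  qed
  ultimately have "0 < a_coeff \<alpha> 0 + b_coeff \<alpha> 1" by (simp only:)
  then show ?thesis
    using assms by (simp add: c_coeff_def Gamma_real_pos)
qed

section \<open>Definiteness of the spatial matrix\<close>

text \<open>
  Weak diagonal dominance, in the form \<open>2 x\<^sub>i x\<^sub>j \<le> x\<^sub>i\<^sup>2 + x\<^sub>j\<^sup>2\<close> weighted by the nonnegative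
  off-diagonal entries: the form is at most the sum of \<open>x\<^sub>i\<^sup>2\<close> times the \<open>i\<close>-th row sum. In terms
  of truncated subtraction, \<open>i - j + (j - i)\<close> is the distance of \<open>i\<close> and \<open>j\<close>.
\<close>

lemma symmetric_toeplitz_form_nonpos:
  fixes s x :: "nat \<Rightarrow> real"
  assumes nonneg: "\<And>d. 1 \<le> d \<Longrightarrow> 0 \<le> s d"
    and dominant: "s 0 + 2 * (\<Sum>d=1..n. s d) \<le> 0"
  shows "(\<Sum>i<n. \<Sum>j<n. s (i - j + (j - i)) * (x i * x j)) \<le> 0"
proof -
  define t where "t i j = s (i - j + (j - i))" for i j
  have sym: "t i j = t j i" for i j by (simp add: t_def add.commute)
  have row: "(\<Sum>j<n. t i j) \<le> 0" if "i < n" for i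
  proof -
    \<comment> \<open>Left and right of the diagonal, the row lists \<open>s\<close> at the distances from 1 up to the edge,
      so each side is at most the full sum in the dominance condition.\<close>
    have "{..<n} = {..<i} \<union> ({i} \<union> {i<..<n})" using that by auto
    then have "(\<Sum>j<n. t i j) = (\<Sum>j\<in>{..<i} \<union> ({i} \<union> {i<..<n}). t i j)"
      by (simp only:)
    also have "\<dots> = (\<Sum>j<i. t i j) + (t i i + (\<Sum>j\<in>{i<..<n}. t i j))"
      by (subst sum.union_disjoint) auto
    also have "(\<Sum>j<i. t i j) = (\<Sum>d=1..i. s d)"
      by (rule sum.reindex_bij_witness[of _ "\<lambda>d. i - d" "\<lambda>j. i - j"]) (auto simp: t_def)
    also have "(\<Sum>j\<in>{i<..<n}. t i j) = (\<Sum>d=1..<n - i. s d)"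
      by (rule sum.reindex_bij_witness[of _ "\<lambda>d. d + i" "\<lambda>j. j - i"]) (auto simp: t_def)
    finally have "(\<Sum>j<n. t i j) = (\<Sum>d=1..i. s d) + (s 0 + (\<Sum>d=1..<n - i. s d))"
      by (simp add: t_def)
    moreover have "(\<Sum>d=1..i. s d) \<le> (\<Sum>d=1..n. s d)"
      using that nonneg by (intro sum_mono2) auto
    moreover have "(\<Sum>d=1..<n - i. s d) \<le> (\<Sum>d=1..n. s d)"
      using that nonneg by (intro sum_mono2) auto
    ultimately show ?thesis using dominant by linarith
  qed
  have "2 * (\<Sum>i<n. \<Sum>j<n. t i j * (x i * x j)) = (\<Sum>i<n. \<Sum>j<n. t i j * (2 * (x i * x j)))"
    by (simp add: sum_distrib_left mult_ac)
  also have "\<dots> \<le> (\<Sum>i<n. \<Sum>j<n. t i j * ((x i)\<^sup>2 + (x j)\<^sup>2))"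
  proof (intro sum_mono)
    fix i j
    show "t i j * (2 * (x i * x j)) \<le> t i j * ((x i)\<^sup>2 + (x j)\<^sup>2)"
    proof (cases "i = j")
      case True
      then show ?thesis by (simp add: power2_eq_square)
    next
      case False
      then have "0 \<le> t i j" by (auto simp: t_def intro!: nonneg)
      moreover have "2 * (x i * x j) \<le> (x i)\<^sup>2 + (x j)\<^sup>2"
        using sum_squares_bound[of "x i" "x j"] by simp
      ultimately show ?thesis by (rule mult_left_mono[rotated])
    qed
  qed
  also have "\<dots> = (\<Sum>i<n. \<Sum>j<n. t i j * (x i)\<^sup>2) + (\<Sum>i<n. \<Sum>j<n. t i j * (x j)\<^sup>2)"
    by (simp add: distrib_left sum.distrib)
  also have "(\<Sum>i<n. \<Sum>j<n. t i j * (x j)\<^sup>2) = (\<Sum>i<n. \<Sum>j<n. t i j * (x i)\<^sup>2)"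
    by (subst sum.swap) (simp add: sym)
  also have "(\<Sum>i<n. \<Sum>j<n. t i j * (x i)\<^sup>2) = (\<Sum>i<n. (\<Sum>j<n. t i j) * (x i)\<^sup>2)"
    by (simp add: sum_distrib_right)
  finally have "2 * (\<Sum>i<n. \<Sum>j<n. t i j * (x i * x j)) \<le> 2 * (\<Sum>i<n. (\<Sum>j<n. t i j) * (x i)\<^sup>2)"
    by simp
  moreover have "(\<Sum>i<n. (\<Sum>j<n. t i j) * (x i)\<^sup>2) \<le> 0"
  proof (rule sum_nonpos)
    show "(\<Sum>j<n. t i j) * (x i)\<^sup>2 \<le> 0" if "i \<in> {..<n}" for i
      using row that by (intro mult_nonpos_nonneg) auto
  qed
  ultimately show ?thesis by (simp add: t_def)
qed

lemma G_mat_carrier: "G_mat \<beta> N \<in> carrier_mat (N - 1) (N - 1)"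
  by (simp add: G_mat_def)

text \<open>
  The symmetric part of \<open>G\<close> is the Toeplitz matrix of the sequence \<open>s\<close> below. The entry
  \<open>\<omega>\<^sub>0\<close> above the diagonal meets \<open>\<omega>\<^sub>2\<close> at distance 1, and the entries of \<open>G\<close> further above
  the diagonal vanish.
\<close>

lemma G_mat_form_nonpos:
  assumes \<beta>: "1 < \<beta>" "\<beta> < 2" and N: "2 \<le> N" and v: "v \<in> carrier_vec (N - 1)"
  shows "v \<bullet> (G_mat \<beta> N *\<^sub>v v) \<le> 0"
proof -
  define n where "n = N - 1"
  define x where "x i = v $ i" for i
  define g where "g i j = (if j \<le> i + 1 then omega_coeff \<beta> (i + 1 - j) else 0)" for i j :: nat
  define s where "s d = (if d = 0 then omega_coeff \<beta> 1
    else if d = 1 then (omega_coeff \<beta> 0 + omega_coeff \<beta> 2) / 2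
    else omega_coeff \<beta> (Suc d) / 2)" for d
  have n: "1 \<le> n" using N by (simp add: n_def)
  have form: "v \<bullet> (G_mat \<beta> N *\<^sub>v v) = (\<Sum>i<n. \<Sum>j<n. g i j * (x i * x j))"
    using v by (simp add: scalar_prod_def G_mat_def n_def g_def x_def
        sum_distrib_left atLeast0LessThan mult_ac)
  have symmetrised: "g i j + g j i = 2 * s (i - j + (j - i))" for i j
  proof (cases i j rule: linorder_cases)
    case less
    then obtain d where "j = i + Suc d" using less_imp_Suc_add by auto
    then show ?thesis by (cases d) (auto simp: g_def s_def numeral_2_eq_2 numeral_3_eq_3 simp del: omega_coeff.simps)
  next
    case greater
    then obtain d where "i = j + Suc d" using less_imp_Suc_add by auto
    then show ?thesis by (cases d) (auto simp: g_def s_def numeral_2_eq_2 numeral_3_eq_3 simp del: omega_coeff.simps)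
  qed (simp add: g_def s_def)
  have "2 * (\<Sum>i<n. \<Sum>j<n. g i j * (x i * x j))
      = (\<Sum>i<n. \<Sum>j<n. g i j * (x i * x j)) + (\<Sum>i<n. \<Sum>j<n. g j i * (x i * x j))"
    by (subst (3) sum.swap) (simp add: mult_ac)
  also have "\<dots> = (\<Sum>i<n. \<Sum>j<n. (g i j + g j i) * (x i * x j))"
    by (simp add: sum.distrib distrib_right)
  also have "\<dots> = 2 * (\<Sum>i<n. \<Sum>j<n. s (i - j + (j - i)) * (x i * x j))"
    unfolding symmetrised by (simp add: sum_distrib_left mult_ac)
  also have "(\<Sum>i<n. \<Sum>j<n. s (i - j + (j - i)) * (x i * x j)) \<le> 0"
  proof (rule symmetric_toeplitz_form_nonpos)
    show "0 \<le> s d" if "1 \<le> d" for d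
      using that omega_coeff_nonneg[OF \<beta>, of "Suc d"] omega_coeff_0_2_nonneg[OF \<beta>]
      by (simp add: s_def del: omega_coeff.simps)
    have "s 0 + 2 * (\<Sum>d=1..n. s d) = (\<Sum>k\<le>Suc n. omega_coeff \<beta> k)"
      using n
    proof (induction n rule: dec_induct)
      case base
      show ?case by (simp add: s_def numeral_2_eq_2 del: omega_coeff.simps)
    next
      case (step m)
      then show ?case by (simp add: s_def del: omega_coeff.simps)
    qed
    then show "s 0 + 2 * (\<Sum>d=1..n. s d) \<le> 0"
      using sum_omega_coeff_nonpos[OF \<beta> n] by simp
  qed
  finally show ?thesis using form by simp
qed

lemma K_mat_carrier: "K_mat \<beta> e1 e2 N \<in> carrier_mat (N - 1) (N - 1)"
  unfolding K_mat_def
  by (intro add_carrier_mat smult_carrier_mat transpose_carrier_mat[THEN iffD2] G_mat_carrier)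

lemma smult_mat_mult_vec:
  fixes A :: "'a :: comm_ring_1 mat"
  assumes "A \<in> carrier_mat nr nc" "v \<in> carrier_vec nc"
  shows "(k \<cdot>\<^sub>m A) *\<^sub>v v = k \<cdot>\<^sub>v (A *\<^sub>v v)"
  using assms by (intro eq_vecI) auto

lemma K_mat_form_nonpos:
  assumes \<beta>: "1 < \<beta>" "\<beta> < 2" and e: "0 \<le> e1" "0 \<le> e2" and N: "2 \<le> N"
    and v: "v \<in> carrier_vec (N - 1)"
  shows "v \<bullet> (K_mat \<beta> e1 e2 N *\<^sub>v v) \<le> 0"
proof -
  let ?G = "G_mat \<beta> N"
  have G: "?G \<in> carrier_mat (N - 1) (N - 1)" "transpose_mat ?G \<in> carrier_mat (N - 1) (N - 1)"
    using G_mat_carrier transpose_carrier_mat[THEN iffD2, OF G_mat_carrier] .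
  have Gv: "?G *\<^sub>v v \<in> carrier_vec (N - 1)" "transpose_mat ?G *\<^sub>v v \<in> carrier_vec (N - 1)"
    using mult_mat_vec_carrier[OF G(1) v] mult_mat_vec_carrier[OF G(2) v] .
  have "v \<bullet> (transpose_mat ?G *\<^sub>v v) = v \<bullet> (?G *\<^sub>v v)"
    using transpose_vec_mult_scalar[OF G(1) v v] comm_scalar_prod[OF v Gv(1)]
      comm_scalar_prod[OF v Gv(2)] by simp
  moreover have "K_mat \<beta> e1 e2 N *\<^sub>v v = e1 \<cdot>\<^sub>v (?G *\<^sub>v v) + e2 \<cdot>\<^sub>v (transpose_mat ?G *\<^sub>v v)"
    unfolding K_mat_def using G v
    by (subst add_mult_distrib_mat_vec[of _ "N - 1" "N - 1"]) (auto simp: smult_mat_mult_vec)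
  ultimately have "v \<bullet> (K_mat \<beta> e1 e2 N *\<^sub>v v) = (e1 + e2) * (v \<bullet> (?G *\<^sub>v v))"
    using v Gv by (simp add: scalar_prod_add_distrib[of _ "N - 1"] distrib_right)
  then show ?thesis
    using G_mat_form_nonpos[OF \<beta> N v] e by (simp add: mult_nonneg_nonpos)
qed

text \<open>
  A positive definite quadratic form excludes a kernel even for a nonsymmetric matrix, such as
  the one that arises for \<open>e\<^sub>1 \<noteq> e\<^sub>2\<close>: on a kernel vector the form vanishes, but it is at least
  \<open>c (v \<bullet> v)\<close>.
\<close>

lemma det_pos_smult_one_minus_nonzero:
  fixes K :: "real mat"
  assumes K: "K \<in> carrier_mat n n"
    and form: "\<And>v. v \<in> carrier_vec n \<Longrightarrow> v \<bullet> (K *\<^sub>v v) \<le> 0"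
    and "0 < c" "0 \<le> k"
  shows "det (c \<cdot>\<^sub>m 1\<^sub>m n - k \<cdot>\<^sub>m K) \<noteq> 0"
proof
  let ?A = "c \<cdot>\<^sub>m 1\<^sub>m n - k \<cdot>\<^sub>m K"
  assume "det ?A = 0"
  moreover have A: "?A \<in> carrier_mat n n" using K by (intro minus_carrier_mat smult_carrier_mat)
  ultimately obtain v where v: "v \<in> carrier_vec n" "v \<noteq> 0\<^sub>v n" "?A *\<^sub>v v = 0\<^sub>v n"
    using det_0_iff_vec_prod_zero_field by blast
  have Kv: "K *\<^sub>v v \<in> carrier_vec n" using mult_mat_vec_carrier[OF K v(1)] .
  have "?A *\<^sub>v v = c \<cdot>\<^sub>v v - k \<cdot>\<^sub>v (K *\<^sub>v v)"
    using K v(1) by (subst minus_mult_distrib_mat_vec[of _ n n])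
      (auto simp: smult_mat_mult_vec[of _ n n])
  then have "v \<bullet> (?A *\<^sub>v v) = c * (v \<bullet> v) - k * (v \<bullet> (K *\<^sub>v v))"
    using v(1) Kv by (simp add: scalar_prod_minus_distrib[of _ n])
  moreover have "v \<bullet> (?A *\<^sub>v v) = 0" using v by simp
  moreover have "0 < v \<bullet> v" using conjugate_square_greater_0_vec[OF v(1)] v(2) by simp
  then have "0 < c * (v \<bullet> v)" using \<open>0 < c\<close> by simp
  moreover have "k * (v \<bullet> (K *\<^sub>v v)) \<le> 0"
    using form[OF v(1)] \<open>0 \<le> k\<close> by (rule mult_nonneg_nonpos[rotated])
  ultimately show False by linarith
qed

lemma A_block_carrier: "A_block \<alpha> \<beta> e1 e2 h \<tau> N k \<in> carrier_mat (N - 1) (N - 1)"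
  using K_mat_carrier[of \<beta> e1 e2 N] by (auto simp: A_block_def Let_def)

lemma det_A_block_0:
  assumes "0 < \<alpha>" "\<alpha> < 1" "1 < \<beta>" "\<beta> < 2" "0 < e1" "0 < e2" "0 < h" "0 < \<tau>" "2 \<le> N"
  shows "det (A_block \<alpha> \<beta> e1 e2 h \<tau> N 0) \<noteq> 0"
proof -
  have "0 < h powr \<beta> * c_coeff \<alpha> \<tau> 0" "0 \<le> offset \<alpha>"
    using c_coeff_0_pos assms by (auto simp: offset_def)
  then show ?thesis
    using det_pos_smult_one_minus_nonzero[OF K_mat_carrier K_mat_form_nonpos] assms
    by (simp add: A_block_def Let_def)
qed

section \<open>Block lower triangular matrices\<close>

lemma block_mat_carrier [simp]: "block_mat m n B \<in> carrier_mat (m * n) (m * n)"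
  by (simp add: block_mat_def)

lemma block_index_less:
  fixes i r m n :: nat
  assumes "i < m" "r < n"
  shows "i * n + r < m * n"
proof -
  have "i * n + r < Suc i * n" using assms(2) by simp
  also have "\<dots> \<le> m * n" using assms(1) by (intro mult_le_mono1) simp
  finally show ?thesis .
qed

lemma block_mat_mult_vec_index:
  assumes v: "v \<in> carrier_vec (m * n)" and B: "\<And>j. j < m \<Longrightarrow> B i j \<in> carrier_mat n n"
    and i: "i < m" and r: "r < n"
  shows "(block_mat m n B *\<^sub>v v) $ (i * n + r)
    = (\<Sum>j<m. (B i j *\<^sub>v vec n (\<lambda>q. v $ (j * n + q))) $ r)"
proof -
  have ir: "i * n + r < m * n" using block_index_less[OF i r] .
  have "(block_mat m n B *\<^sub>v v) $ (i * n + r)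
      = (\<Sum>k<m * n. B i (k div n) $$ (r, k mod n) * v $ k)"
    using v ir r by (simp add: block_mat_def scalar_prod_def atLeast0LessThan)
  also have "\<dots> = (\<Sum>j<m. \<Sum>k=j * n..<j * n + n. B i (k div n) $$ (r, k mod n) * v $ k)"
    by (rule sum.nat_group[symmetric])
  also have "\<dots> = (\<Sum>j<m. \<Sum>q<n. B i j $$ (r, q) * v $ (j * n + q))"
  proof (rule sum.cong[OF refl])
    fix j
    show "(\<Sum>k=j * n..<j * n + n. B i (k div n) $$ (r, k mod n) * v $ k)
        = (\<Sum>q<n. B i j $$ (r, q) * v $ (j * n + q))"
      by (rule sum.reindex_bij_witness[of _ "\<lambda>q. j * n + q" "\<lambda>k. k - j * n"])
        (auto simp: div_nat_eqI mod_nat_eqI le_mod_geq algebra_simps dest!: le_Suc_ex)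
  qed
  also have "\<dots> = (\<Sum>j<m. (B i j *\<^sub>v vec n (\<lambda>q. v $ (j * n + q))) $ r)"
    using B r by (intro sum.cong refl) (force simp: scalar_prod_def atLeast0LessThan)
  finally show ?thesis .
qed

text \<open>
  Forward substitution: if the block vectors \<open>w\<^sub>j\<close> with \<open>j < i\<close> of a kernel vector vanish, the
  \<open>i\<close>-th block row reads \<open>B\<^sub>i\<^sub>i w\<^sub>i = 0\<close>, and the nonsingular diagonal block forces \<open>w\<^sub>i = 0\<close>.
\<close>

lemma det_block_lower_triangular_nonzero:
  fixes B :: "nat \<Rightarrow> nat \<Rightarrow> 'a :: field mat"
  assumes B: "\<And>i j. i < m \<Longrightarrow> j < m \<Longrightarrow> B i j \<in> carrier_mat n n"
    and upper: "\<And>i j. i < j \<Longrightarrow> j < m \<Longrightarrow> B i j = 0\<^sub>m n n"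
    and diag: "\<And>i. i < m \<Longrightarrow> det (B i i) \<noteq> 0"
  shows "det (block_mat m n B) \<noteq> 0"
proof
  assume "det (block_mat m n B) = 0"
  then obtain v where v: "v \<in> carrier_vec (m * n)" "v \<noteq> 0\<^sub>v (m * n)"
    "block_mat m n B *\<^sub>v v = 0\<^sub>v (m * n)"
    using det_0_iff_vec_prod_zero_field block_mat_carrier by blast
  define w where "w j = vec n (\<lambda>q. v $ (j * n + q))" for j
  have w: "w j \<in> carrier_vec n" for j by (simp add: w_def)
  have blocks: "w i = 0\<^sub>v n" if "i < m" for i
    using that
  proof (induction i rule: less_induct)
    case (less i)
    have "B i i *\<^sub>v w i = 0\<^sub>v n"
    proof (rule eq_vecI)
      fix r
      assume "r < dim_vec (0\<^sub>v n :: 'a vec)"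
      then have r: "r < n" by simp
      have "(B i j *\<^sub>v w j) $ r = 0" if j: "j < m" "j \<noteq> i" for j
      proof (cases "j < i")
        case True
        then have "w j = 0\<^sub>v n" using less.IH j by simp
        then show ?thesis using B[OF less.prems j(1)] r by auto
      next
        case False
        then have "B i j = 0\<^sub>m n n" using upper j by simp
        then show ?thesis using r w[of j] by simp
      qed
      then have "(\<Sum>j<m. (B i j *\<^sub>v w j) $ r) = (\<Sum>j<m. if j = i then (B i i *\<^sub>v w i) $ r else 0)"
        by (intro sum.cong) auto
      also have "\<dots> = (B i i *\<^sub>v w i) $ r" using less.prems by simp
      finally show "(B i i *\<^sub>v w i) $ r = 0\<^sub>v n $ r"
        using block_mat_mult_vec_index[of v m n B i r, OF v(1) B[OF less.prems] less.prems r] v(3) r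
          block_index_less[OF less.prems r]
        by (simp add: w_def)
    qed (use B[OF less.prems less.prems] in auto)
    then show ?case
      using diag[OF less.prems] det_0_iff_vec_prod_zero_field[OF B[OF less.prems less.prems]] w
      by blast
  qed
  have "v = 0\<^sub>v (m * n)"
  proof (rule eq_vecI)
    fix k
    assume "k < dim_vec (0\<^sub>v (m * n) :: 'a vec)"
    then have k: "k < m * n" by simp
    then have n: "0 < n" by (cases n) auto
    have "k div n < m" using k by (simp add: less_mult_imp_div_less)
    then have "w (k div n) $ (k mod n) = 0" using blocks n by simp
    then show "v $ k = 0\<^sub>v (m * n) $ k" using k n by (simp add: w_def)
  qed (use v in simp)
  then show False using v(2) by simp
qed

lemma block_mat_pencil:
  assumes "\<And>i j. i < m \<Longrightarrow> j < m \<Longrightarrow> B i j \<in> carrier_mat n n"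
    and "\<And>i j. i < m \<Longrightarrow> j < m \<Longrightarrow> C i j \<in> carrier_mat n n"
  shows "map_mat f (block_mat m n B) - k \<cdot>\<^sub>m map_mat f (block_mat m n C)
    = block_mat m n (\<lambda>i j. map_mat f (B i j) - k \<cdot>\<^sub>m map_mat f (C i j))"
proof (rule eq_matI)
  fix a b
  assume "a < dim_row (block_mat m n (\<lambda>i j. map_mat f (B i j) - k \<cdot>\<^sub>m map_mat f (C i j)))"
    and "b < dim_col (block_mat m n (\<lambda>i j. map_mat f (B i j) - k \<cdot>\<^sub>m map_mat f (C i j)))"
  then have ab: "a < m * n" "b < m * n" by (simp_all add: block_mat_def)
  then have "0 < n" by (cases n) auto
  then have "a div n < m" "b div n < m" "a mod n < n" "b mod n < n"
    using ab by (simp_all add: less_mult_imp_div_less)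
  moreover have "B (a div n) (b div n) \<in> carrier_mat n n" "C (a div n) (b div n) \<in> carrier_mat n n"
    using assms calculation by auto
  ultimately show "(map_mat f (block_mat m n B) - k \<cdot>\<^sub>m map_mat f (block_mat m n C)) $$ (a, b)
      = block_mat m n (\<lambda>i j. map_mat f (B i j) - k \<cdot>\<^sub>m map_mat f (C i j)) $$ (a, b)"
    using ab by (simp add: block_mat_def)
qed (simp_all add: block_mat_def)

section \<open>The preconditioned matrix\<close>

lemma det_nonzero_mat_inverse:
  fixes A :: "'a :: field mat"
  assumes A: "A \<in> carrier_mat n n" and det: "det A \<noteq> 0"
  shows "the (mat_inverse A) \<in> carrier_mat n n"
    and "A * the (mat_inverse A) = 1\<^sub>m n" and "the (mat_inverse A) * A = 1\<^sub>m n"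
proof -
  have "A \<in> Units (ring_mat TYPE('a) n ())"
    using det_non_zero_imp_unit[OF A det] .
  then obtain B where "mat_inverse A = Some B"
    using mat_inverse(1)[OF A, where b = "()"] by (cases "mat_inverse A") auto
  then show "the (mat_inverse A) \<in> carrier_mat n n"
    and "A * the (mat_inverse A) = 1\<^sub>m n" and "the (mat_inverse A) * A = 1\<^sub>m n"
    using mat_inverse(2)[OF A] by auto
qed

text \<open>
  The eigenvalue equation is multiplied by \<open>P\<close>, which turns it into singularity of the pencil
  \<open>W - k P\<close> and removes the inverse. Determinants commute with the embedding of the reals
  into the complex numbers, so real nonsingularity of the diagonal blocks is enough.
\<close>

lemma spectrum_preconditioned_block_lower_triangular:
  fixes B C :: "nat \<Rightarrow> nat \<Rightarrow> real mat"
  assumes B: "\<And>i j. i < m \<Longrightarrow> j < m \<Longrightarrow> B i j \<in> carrier_mat n n"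
    and C: "\<And>i j. i < m \<Longrightarrow> j < m \<Longrightarrow> C i j \<in> carrier_mat n n"
    and upper: "\<And>i j. i < j \<Longrightarrow> j < m \<Longrightarrow> B i j = 0\<^sub>m n n"
      "\<And>i j. i < j \<Longrightarrow> j < m \<Longrightarrow> C i j = 0\<^sub>m n n"
    and diag: "\<And>i. i < m \<Longrightarrow> B i i = C i i" "\<And>i. i < m \<Longrightarrow> det (C i i) \<noteq> 0"
    and "0 < m" "0 < n"
  shows "spectrum (map_mat complex_of_real (the (mat_inverse (block_mat m n C)) * block_mat m n B)) = {1}"
proof -
  let ?h = "map_mat complex_of_real"
  define W P where "W = block_mat m n B" and "P = block_mat m n C"
  define Q where "Q = the (mat_inverse P) * W"
  have W: "W \<in> carrier_mat (m * n) (m * n)" and P: "P \<in> carrier_mat (m * n) (m * n)"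
    by (simp_all add: W_def P_def)
  have "det P \<noteq> 0"
    unfolding P_def using C upper diag by (intro det_block_lower_triangular_nonzero) auto
  note inv = det_nonzero_mat_inverse[OF P this]
  have Q: "Q \<in> carrier_mat (m * n) (m * n)" using inv(1) W by (simp add: Q_def)
  have "P * Q = W"
    using assoc_mult_mat[OF P inv(1) W] inv(2) W by (simp add: Q_def)
  then have PQ: "?h P * ?h Q = ?h W"
    using of_real_hom.mat_hom_mult[OF P Q] by metis
  have one: "k = 1" if k: "k \<in> spectrum (?h Q)" for k
  proof (rule ccontr)
    assume "k \<noteq> 1"
    from k obtain v where v: "v \<in> carrier_vec (m * n)" "v \<noteq> 0\<^sub>v (m * n)" "?h Q *\<^sub>v v = k \<cdot>\<^sub>v v"
      using Q by (auto simp: spectrum_def eigenvalue_def eigenvector_def)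
    have hP: "?h P \<in> carrier_mat (m * n) (m * n)" and hQ: "?h Q \<in> carrier_mat (m * n) (m * n)"
      and hW: "?h W \<in> carrier_mat (m * n) (m * n)" using P Q W by auto
    have "?h W *\<^sub>v v = ?h P *\<^sub>v (?h Q *\<^sub>v v)"
      unfolding PQ[symmetric] using hP hQ v(1) by (rule assoc_mult_mat_vec)
    also have "\<dots> = k \<cdot>\<^sub>v (?h P *\<^sub>v v)"
      unfolding v(3) using hP v(1) by (rule mult_mat_vec)
    finally have "(?h W - k \<cdot>\<^sub>m ?h P) *\<^sub>v v = 0\<^sub>v (m * n)"
      using minus_mult_distrib_mat_vec[OF hW smult_carrier_mat[OF hP] v(1)]
        smult_mat_mult_vec[OF hP v(1)] mult_mat_vec_carrier[OF hP v(1)] by simp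
    moreover have "?h W - k \<cdot>\<^sub>m ?h P \<in> carrier_mat (m * n) (m * n)"
      using hP by (intro minus_carrier_mat smult_carrier_mat)
    ultimately have "det (?h W - k \<cdot>\<^sub>m ?h P) = 0"
      using v det_0_iff_vec_prod_zero_field by blast
    moreover have "det (?h W - k \<cdot>\<^sub>m ?h P) \<noteq> 0"
    proof -
      have "?h W - k \<cdot>\<^sub>m ?h P = block_mat m n (\<lambda>i j. ?h (B i j) - k \<cdot>\<^sub>m ?h (C i j))"
        unfolding W_def P_def by (rule block_mat_pencil) (simp_all add: B C)
      moreover have "det (block_mat m n (\<lambda>i j. ?h (B i j) - k \<cdot>\<^sub>m ?h (C i j))) \<noteq> 0"
      proof (rule det_block_lower_triangular_nonzero)
        show "?h (B i j) - k \<cdot>\<^sub>m ?h (C i j) \<in> carrier_mat n n" if "i < m" "j < m" for i j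
          using C[OF that] by (intro minus_carrier_mat smult_carrier_mat) simp
        show "?h (B i j) - k \<cdot>\<^sub>m ?h (C i j) = 0\<^sub>m n n" if "i < j" "j < m" for i j
          unfolding upper(1)[OF that] upper(2)[OF that] by (intro eq_matI) simp_all
        show "det (?h (B i i) - k \<cdot>\<^sub>m ?h (C i i)) \<noteq> 0" if i: "i < m" for i
        proof -
          have "?h (B i i) - k \<cdot>\<^sub>m ?h (C i i) = (1 - k) \<cdot>\<^sub>m ?h (C i i)"
            using C[OF i i] diag(1)[OF i] by (intro eq_matI) (auto simp: left_diff_distrib)
          then show ?thesis using \<open>k \<noteq> 1\<close> diag(2)[OF i] by simp
        qed
      qed
      ultimately show ?thesis by (simp only: not_False_eq_True)
    qed
    ultimately show False by simp
  qed
  moreover have "spectrum (?h Q) \<noteq> {}"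
    using spectrum_non_empty[of "?h Q" "m * n"] Q \<open>0 < m\<close> \<open>0 < n\<close> by simp
  ultimately have "spectrum (?h Q) = {1}" by blast
  then show ?thesis by (simp add: Q_def P_def W_def)
qed

theorem theorem3p2:
  fixes \<alpha> \<beta> e1 e2 L T :: real and N M :: nat
  assumes "0 < \<alpha>" and "\<alpha> < 1"
    and "1 < \<beta>" and "\<beta> < 2"
    and "0 < e1" and "0 < e2"
    and "0 < L" and "0 < T"
    and "2 \<le> N" and "2 \<le> M"
  shows "invertible_mat (P_mat \<alpha> \<beta> e1 e2 L T N M) \<and>
    spectrum (map_mat complex_of_real
      (the (mat_inverse (P_mat \<alpha> \<beta> e1 e2 L T N M)) * W_mat \<alpha> \<beta> e1 e2 L T N M)) = {1}"
proof
  let ?m = "M - 1" and ?n = "N - 1"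
  let ?A = "A_block \<alpha> \<beta> e1 e2 (L / real N) (T / real M) N"
  define B where "B i j = (if j \<le> i then ?A (i - j) else 0\<^sub>m ?n ?n)" for i j
  define C where "C i j = (if i = j then ?A 0 else if i = j + 1 then ?A 1 else 0\<^sub>m ?n ?n)"
    for i j :: nat
  have W: "W_mat \<alpha> \<beta> e1 e2 L T N M = block_mat ?m ?n B"
    by (simp add: W_mat_def B_def[abs_def] Let_def)
  have P: "P_mat \<alpha> \<beta> e1 e2 L T N M = block_mat ?m ?n C"
    by (simp add: P_mat_def C_def[abs_def] Let_def)
  have "det (?A 0) \<noteq> 0" using assms by (intro det_A_block_0) auto
  then have diag: "det (C i i) \<noteq> 0" for i by (simp add: C_def)
  have carrier: "B i j \<in> carrier_mat ?n ?n" "C i j \<in> carrier_mat ?n ?n" for i j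
    unfolding B_def C_def by (simp_all add: A_block_carrier[simplified])
  have upper: "B i j = 0\<^sub>m ?n ?n" "C i j = 0\<^sub>m ?n ?n" if "i < j" for i j
    using that by (simp_all add: B_def C_def)
  have "det (block_mat ?m ?n C) \<noteq> 0"
    using carrier upper diag by (intro det_block_lower_triangular_nonzero) auto
  note inv = det_nonzero_mat_inverse[OF block_mat_carrier this]
  show "invertible_mat (P_mat \<alpha> \<beta> e1 e2 L T N M)"
    unfolding P invertible_mat_def inverts_mat_def square_mat.simps
      carrier_matD[OF block_mat_carrier]
  proof (intro conjI refl exI)
    let ?X = "the (mat_inverse (block_mat ?m ?n C))"
    show "block_mat ?m ?n C * ?X = 1\<^sub>m (?m * ?n)"
      by (rule inv(2))
    show "?X * block_mat ?m ?n C = 1\<^sub>m (dim_row ?X)"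
      unfolding carrier_matD(1)[OF inv(1)] by (rule inv(3))
  qed
  show "spectrum (map_mat complex_of_real
      (the (mat_inverse (P_mat \<alpha> \<beta> e1 e2 L T N M)) * W_mat \<alpha> \<beta> e1 e2 L T N M)) = {1}"
    unfolding W P
  proof (rule spectrum_preconditioned_block_lower_triangular[OF carrier upper _ diag])
    show "B i i = C i i" for i
      by (simp add: B_def C_def)
    show "0 < ?m" "0 < ?n"
      using assms by simp_all
  qed
qed

end
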